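(* Let $\alpha\in[0,1]$ and let $x$ be a random scenario such that the minimum achievable average travel time $\mathcal{T}:=T_{\min}(x)$ has a continuous distribution with density $\varphi$ supported on $[a,b]$. Set $$J(r)=\alpha\,\mathbb{E}\big[\max\{\mathcal{T},r\}\big]+(1-\alpha)\,\mathrm{Std}\big[\max\{\mathcal{T},r\}\big].$$ Then the optimal control function for the variational problem of minimizing $$\alpha\,\mathbb{E}[T(x)]+(1-\alpha)\,\mathrm{Std}[T(x)]$$ over all control functions $T$ with $T(x)\ge T_{\min}(x)$ for all $x$ takes the form $$T(x)=\max\{r^*,T_{\min}(x)\},$$ where $r^*$ is the unique solution to $J'(r)=0$. This reduction transforms an infinite-dimensional optimization problem into a smooth one-dimensional root-finding problem, solvable using elementary numerical methods.
   Context: $T(x)$ is the average travel time per vehicle assigned by the controller to scenario $x$ (the realization of the random daily peak demand), and $T_{\min}(x)$ is the given minimum achievable average travel time in scenario $x$. $\mathbb{E}$ and $\mathrm{Std}$ denote expectation and standard deviation with respect to the random scenario. $J'$ denotes the derivative of $J$ with respect to the scalar $r$.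
   Formalization: J'(r)=0 for all r ≤ a (and r ≥ b if α=0), so the root is unique only on (a,b]; if none exists there, r*=a. a and b are the end points of the support. Optimal controls are unique a.e. if α>0. Smooth means C¹; the remark on numerical methods is not formalized. *)

theory Defs
  imports "HOL-Probability.Probability"
begin

text \<open>
  Scenarios are the points of a probability space \<open>M\<close>; controls are real-valued functions on it.
\<close>

definition std_dev :: "'x measure \<Rightarrow> ('x \<Rightarrow> real) \<Rightarrow> real" where
  "std_dev M X = sqrt (prob_space.variance M X)"

text \<open>
  The Bochner integral of a non-integrable function is 0, so the cost of an arbitrary control is
  taken in the extended reals. The value \<open>\<infinity>\<close> below is the right one for functions bounded below
  almost everywhere, which holds for every control dominating the minimal travel time. The product
  of 0 and \<open>\<infinity>\<close> is 0 in \<^typ>\<open>ereal\<close>, so a vanishing weight removes its term.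
\<close>

definition ext_expectation :: "'x measure \<Rightarrow> ('x \<Rightarrow> real) \<Rightarrow> ereal" where
  "ext_expectation M X = (if integrable M X then ereal (prob_space.expectation M X) else \<infinity>)"

definition ext_std_dev :: "'x measure \<Rightarrow> ('x \<Rightarrow> real) \<Rightarrow> ereal" where
  "ext_std_dev M X = (if integrable M (\<lambda>x. (X x)\<^sup>2) then ereal (std_dev M X) else \<infinity>)"

definition cost :: "real \<Rightarrow> 'x measure \<Rightarrow> ('x \<Rightarrow> real) \<Rightarrow> ereal" where
  "cost \<alpha> M T = ereal \<alpha> * ext_expectation M T + ereal (1 - \<alpha>) * ext_std_dev M T"

definition admissible :: "'x measure \<Rightarrow> ('x \<Rightarrow> real) \<Rightarrow> ('x \<Rightarrow> real) \<Rightarrow> bool" where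
  "admissible M Tmin T \<longleftrightarrow> T \<in> borel_measurable M \<and> (\<forall>x\<in>space M. Tmin x \<le> T x)"

definition optimal_control ::
  "real \<Rightarrow> 'x measure \<Rightarrow> ('x \<Rightarrow> real) \<Rightarrow> ('x \<Rightarrow> real) \<Rightarrow> bool" where
  "optimal_control \<alpha> M Tmin T \<longleftrightarrow>
     admissible M Tmin T \<and> (\<forall>T'. admissible M Tmin T' \<longrightarrow> cost \<alpha> M T \<le> cost \<alpha> M T')"

definition J :: "real \<Rightarrow> 'x measure \<Rightarrow> ('x \<Rightarrow> real) \<Rightarrow> real \<Rightarrow> real" where
  "J \<alpha> M Tmin r =
     \<alpha> * prob_space.expectation M (\<lambda>x. max (Tmin x) r)
     + (1 - \<alpha>) * std_dev M (\<lambda>x. max (Tmin x) r)"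

text \<open>
  \<open>\<phi>\<close> lives on \<open>[a, b]\<close>, and \<open>a\<close> and \<open>b\<close> are the actual end points of its support: each carries
  mass in every one-sided neighbourhood. Gaps inside the interval are allowed. Integrals are used
  because a density is determined only up to null sets.
\<close>

definition supported_on :: "(real \<Rightarrow> real) \<Rightarrow> real \<Rightarrow> real \<Rightarrow> bool" where
  "supported_on \<phi> a b \<longleftrightarrow>
     (AE t in lborel. t \<notin> {a..b} \<longrightarrow> \<phi> t = 0) \<and>
     (\<forall>e>0. 0 < (\<integral>\<^sup>+t\<in>{a..a + e}. ennreal (\<phi> t) \<partial>lborel)) \<and>
     (\<forall>e>0. 0 < (\<integral>\<^sup>+t\<in>{b - e..b}. ennreal (\<phi> t) \<partial>lborel))"

text \<open>
  With \<open>F\<close> the distribution function, \<open>m r\<close> and \<open>s r\<close> the mean and standard deviation of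
  \<open>max \<T> r\<close>, one has \<open>J' r = F r * (\<alpha> - (1 - \<alpha>) * (m r - r) / s r)\<close> for \<open>r < b\<close> and \<open>J' r = \<alpha>\<close>
  for \<open>r \<ge> b\<close>. The factor \<open>F\<close> vanishes on \<open>r \<le> a\<close>, where \<open>J\<close> is constant and \<open>max \<T> r\<close> equals \<open>\<T>\<close>
  almost surely; and if \<open>\<alpha> = 0\<close>, then \<open>J'\<close> also vanishes on all of \<open>r \<ge> b\<close>. Uniqueness of the
  root of \<open>J'\<close> is therefore meant on \<open>a < r \<le> b\<close>. A root exists there exactly when the
  second factor is negative just to the right of \<open>a\<close>, that is, when
  \<open>nontrivial_threshold\<close> holds; otherwise the threshold degenerates to \<open>a\<close>.
\<close>

definition nontrivial_threshold :: "real \<Rightarrow> 'x measure \<Rightarrow> ('x \<Rightarrow> real) \<Rightarrow> real \<Rightarrow> bool" where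
  "nontrivial_threshold \<alpha> M Tmin a \<longleftrightarrow>
     \<alpha> * std_dev M Tmin < (1 - \<alpha>) * (prob_space.expectation M Tmin - a)"

end

theory Submission imports Defs begin

text \<open>
  Write \<open>X\<close> for \<open>T\<^sub>m\<^sub>i\<^sub>n\<close>, \<open>Y = max (X - r) 0\<close>, \<open>u = E Y\<close>, \<open>v = E Y\<^sup>2\<close>, \<open>w = Var Y\<close> and \<open>F\<close> for the
  distribution function. Then \<open>u' = F - 1\<close> and \<open>v' = - 2 u\<close> give
  \<open>J' = F (\<alpha> - (1 - \<alpha>) h)\<close> with \<open>h = u / sqrt w\<close>, and the strict Cauchy--Schwarz inequality
  \<open>u\<^sup>2 < (1 - F) v\<close> makes \<open>h\<close> strictly decreasing up to \<open>b\<close>, where it vanishes continuously.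

  For optimality, the standard deviation of a control \<open>T\<close> is bounded below by its covariance with
  \<open>Y\<close> divided by \<open>sqrt w\<close>. At the root of \<open>J'\<close> the excess cost of \<open>T\<close> over \<open>T\<^sup>* = max r X\<close> is
  therefore at least \<open>(1 - \<alpha>) E ((T - T\<^sup>*) Y) / sqrt w\<close>, which is nonnegative because \<open>T \<ge> X = T\<^sup>*\<close>
  wherever \<open>Y > 0\<close>; if there is no root above \<open>a\<close>, take \<open>r = a\<close>, where \<open>T\<^sup>* = X\<close> almost surely.
  Equality forces \<open>T\<close> to be affine in \<open>Y\<close> and to agree with \<open>X\<close> where
  \<open>X > r\<close>; as \<open>X\<close> has no atoms, the affine map is the one of \<open>T\<^sup>*\<close>.
\<close>

section \<open>Derivatives from remainder bounds; products of square-integrable functions\<close>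

lemma has_real_derivative_of_remainder:
  fixes f :: "real \<Rightarrow> real"
  assumes bound: "\<And>y. \<bar>f y - f x - D * (y - x)\<bar> \<le> \<bar>y - x\<bar> * e y"
    and e: "(e \<longlongrightarrow> 0) (at x)"
  shows "(f has_real_derivative D) (at x)"
proof -
  have "((\<lambda>y. (f y - f x) / (y - x) - D) \<longlongrightarrow> 0) (at x)"
  proof (rule Lim_null_comparison[OF _ e])
    have "norm ((f y - f x) / (y - x) - D) \<le> e y" if "y \<noteq> x" for y
    proof -
      have "(f y - f x) / (y - x) - D = (f y - f x - D * (y - x)) / (y - x)"
        using that by (simp add: field_simps)
      then show ?thesis
        using bound[of y] that by (simp add: abs_divide divide_le_eq mult.commute)
    qed
    then show "\<forall>\<^sub>F y in at x. norm ((f y - f x) / (y - x) - D) \<le> e y"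
      by (auto simp: eventually_at_filter)
  qed
  then show ?thesis
    unfolding has_field_derivative_iff by (rule LIM_zero_cancel)
qed

lemma integrable_mult_of_squares:
  fixes f g :: "'a \<Rightarrow> real"
  assumes [measurable]: "f \<in> borel_measurable M" "g \<in> borel_measurable M"
    and "integrable M (\<lambda>x. (f x)\<^sup>2)" "integrable M (\<lambda>x. (g x)\<^sup>2)"
  shows "integrable M (\<lambda>x. f x * g x)"
proof (rule Bochner_Integration.integrable_bound)
  show "integrable M (\<lambda>x. (f x)\<^sup>2 + (g x)\<^sup>2)" using assms by simp
  have "\<bar>s * t\<bar> \<le> s\<^sup>2 + t\<^sup>2" for s t :: real
  proof -
    have "0 \<le> (\<bar>s\<bar> - \<bar>t\<bar>)\<^sup>2" "0 \<le> \<bar>s\<bar> * \<bar>t\<bar>" by simp_all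
    then show ?thesis unfolding abs_mult power2_diff power2_abs by linarith
  qed
  then show "AE x in M. norm (f x * g x) \<le> norm ((f x)\<^sup>2 + (g x)\<^sup>2)"
    by (auto intro: order_trans)
qed simp

section \<open>Covariance, Cauchy--Schwarz and its equality case\<close>

definition covariance :: "'x measure \<Rightarrow> ('x \<Rightarrow> real) \<Rightarrow> ('x \<Rightarrow> real) \<Rightarrow> real" where
  "covariance M S Z =
     (\<integral>x. (S x - prob_space.expectation M S) * (Z x - prob_space.expectation M Z) \<partial>M)"

context prob_space
begin

lemma AE_eq_expectation:
  fixes S :: "'a \<Rightarrow> real"
  assumes [measurable]: "S \<in> borel_measurable M"
    and S2: "integrable M (\<lambda>x. (S x)\<^sup>2)" and "variance S = 0"
  shows "AE x in M. S x = expectation S"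
proof -
  have integrable_S: "integrable M S"
    using S2 by (auto intro: square_integrable_imp_integrable)
  have "integrable M (\<lambda>x. (S x - expectation S)\<^sup>2)"
    unfolding power2_diff using integrable_S S2 by simp
  then have "AE x in M. (S x - expectation S)\<^sup>2 = 0"
    using assms(3) by (subst (asm) integral_nonneg_eq_0_iff_AE) auto
  then show ?thesis by eventually_elim simp
qed

context
  fixes S Z :: "'a \<Rightarrow> real"
  assumes S_meas [measurable]: "S \<in> borel_measurable M" and Z_meas [measurable]: "Z \<in> borel_measurable M"
    and S2: "integrable M (\<lambda>x. (S x)\<^sup>2)" and Z2: "integrable M (\<lambda>x. (Z x)\<^sup>2)"
begin

lemma integrable_S: "integrable M S" and integrable_Z: "integrable M Z" and integrable_SZ: "integrable M (\<lambda>x. S x * Z x)"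
  using S2 Z2 by (auto intro: square_integrable_imp_integrable integrable_mult_of_squares)

lemma covariance_eq:
  "covariance M S Z = expectation (\<lambda>x. S x * Z x) - expectation S * expectation Z"
proof -
  have "(S x - expectation S) * (Z x - expectation Z)
      = S x * Z x - expectation Z * S x - expectation S * Z x + expectation S * expectation Z" for x
    by (simp add: algebra_simps)
  then show ?thesis using integrable_S integrable_Z integrable_SZ by (simp add: covariance_def prob_space)
qed

lemma diff_scaled_sq: "(S x - l * Z x)\<^sup>2 = (S x)\<^sup>2 - 2 * l * (S x * Z x) + l\<^sup>2 * (Z x)\<^sup>2"
  by (simp add: power2_eq_square algebra_simps)

lemma integrable_diff_scaled_sq: "integrable M (\<lambda>x. (S x - l * Z x)\<^sup>2)"
  unfolding diff_scaled_sq using S2 Z2 integrable_SZ by simp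

lemma variance_diff_scaled:
  "variance (\<lambda>x. S x - l * Z x) = variance S - 2 * l * covariance M S Z + l\<^sup>2 * variance Z"
proof -
  have "expectation (\<lambda>x. (S x - l * Z x)\<^sup>2)
      = expectation (\<lambda>x. (S x)\<^sup>2) - 2 * l * expectation (\<lambda>x. S x * Z x) + l\<^sup>2 * expectation (\<lambda>x. (Z x)\<^sup>2)"
    unfolding diff_scaled_sq using S2 Z2 integrable_SZ by simp
  moreover have "variance (\<lambda>x. S x - l * Z x)
      = expectation (\<lambda>x. (S x - l * Z x)\<^sup>2) - (expectation S - l * expectation Z)\<^sup>2"
    using integrable_S integrable_Z integrable_diff_scaled_sq by (subst variance_eq) auto
  ultimately show ?thesis
    unfolding covariance_eq variance_eq[OF integrable_S S2] variance_eq[OF integrable_Z Z2]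
    by (simp add: power2_eq_square algebra_simps)
qed

text \<open>The coefficient is the regression slope of \<open>S\<close> on \<open>Z\<close>, which
  minimizes the quadratic of \<open>variance_diff_scaled\<close> in \<open>l\<close>. Nonnegativity
  of the residual variance is Cauchy--Schwarz; its vanishing is the equality case.\<close>

lemma variance_residual:
  assumes "0 < variance Z"
  shows "variance (\<lambda>x. S x - covariance M S Z / variance Z * Z x)
    = variance S - (covariance M S Z)\<^sup>2 / variance Z"
  using assms unfolding variance_diff_scaled by (simp add: power2_eq_square field_simps)

lemma covariance_le:
  assumes "0 < variance Z"
  shows "covariance M S Z \<le> sqrt (variance S) * sqrt (variance Z)"
proof -
  have "0 \<le> variance S - (covariance M S Z)\<^sup>2 / variance Z"
    unfolding variance_residual[OF assms, symmetric] by (rule variance_positive)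
  then have "(covariance M S Z)\<^sup>2 \<le> variance S * variance Z"
    using assms by (simp add: field_simps)
  then have "sqrt ((covariance M S Z)\<^sup>2) \<le> sqrt (variance S * variance Z)"
    by (rule real_sqrt_le_mono)
  then have "\<bar>covariance M S Z\<bar> \<le> sqrt (variance S) * sqrt (variance Z)"
    by (simp only: real_sqrt_abs real_sqrt_mult)
  then show ?thesis by linarith
qed

text \<open>Equality leaves a regression residual of variance zero, hence almost surely constant.
  The slope may stay existential, because the optimality argument determines it by other
  means.\<close>

lemma covariance_eq_imp_AE_affine:
  assumes "0 < variance Z" "covariance M S Z = sqrt (variance S) * sqrt (variance Z)"
  shows "\<exists>l. AE x in M. S x - expectation S = l * (Z x - expectation Z)"
proof -
  define l where "l = covariance M S Z / variance Z"
  have "(covariance M S Z)\<^sup>2 = variance S * variance Z"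
    unfolding assms(2) by (simp add: power_mult_distrib variance_positive)
  then have "variance (\<lambda>x. S x - l * Z x) = 0"
    using variance_residual[OF assms(1)] assms(1) by (simp add: l_def)
  moreover note integrable_diff_scaled_sq
  ultimately have "AE x in M. S x - l * Z x = expectation (\<lambda>x. S x - l * Z x)"
    by (intro AE_eq_expectation) auto
  then have "AE x in M. S x - expectation S = l * (Z x - expectation Z)"
    by eventually_elim (use integrable_S integrable_Z in \<open>simp add: algebra_simps\<close>)
  then show ?thesis by blast
qed

end

end

section \<open>Bounded random variables without atoms and their excess over a level\<close>

locale bounded_atomless_rv = prob_space M for M :: "'x measure" +
  fixes X :: "'x \<Rightarrow> real" and a b :: real
  assumes X_measurable [measurable]: "X \<in> borel_measurable M"
    and AE_range: "AE x in M. a \<le> X x \<and> X x \<le> b"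
    and atomless: "AE x in M. X x \<noteq> c"
    and lower_mass: "a < r \<Longrightarrow> 0 < prob {x \<in> space M. X x \<le> r}"
    and upper_mass: "r < b \<Longrightarrow> 0 < prob {x \<in> space M. r < X x}"
begin

definition F :: "real \<Rightarrow> real" where "F r = prob {x \<in> space M. X x \<le> r}"
definition p :: "real \<Rightarrow> real" where "p r = prob {x \<in> space M. r < X x}"
definition Y :: "real \<Rightarrow> 'x \<Rightarrow> real" where "Y r x = max (X x - r) 0"
definition u :: "real \<Rightarrow> real" where "u r = expectation (Y r)"
definition v :: "real \<Rightarrow> real" where "v r = expectation (\<lambda>x. (Y r x)\<^sup>2)"
definition w :: "real \<Rightarrow> real" where "w r = v r - (u r)\<^sup>2"
text \<open>For \<open>b \<le> r\<close> this is 0 / 0 = 0 by convention. That value is also the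
  limit at \<open>b\<close>, so one formula for \<open>J'\<close> is valid and continuous on the
  whole line.\<close>

definition h :: "real \<Rightarrow> real" where "h r = u r / sqrt (w r)"

lemma Y_measurable [measurable]: "Y r \<in> borel_measurable M"
  unfolding Y_def by measurable

lemma Y_nonneg: "0 \<le> Y r x"
  by (simp add: Y_def)

lemma max_eq_Y: "max (X x) r = r + Y r x"
  by (simp add: Y_def max_def)

lemma AE_Y_bounded: "AE x in M. norm (Y r x) \<le> max (b - r) 0"
  using AE_range by eventually_elim (auto simp: Y_def)

lemma integrable_Y [simp, intro]: "integrable M (Y r)"
  by (rule integrable_const_bound[OF AE_Y_bounded]) simp

lemma integrable_Y_sq [simp, intro]: "integrable M (\<lambda>x. (Y r x)\<^sup>2)"
proof (rule integrable_const_bound)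
  show "AE x in M. norm ((Y r x)\<^sup>2) \<le> (max (b - r) 0)\<^sup>2"
    using AE_Y_bounded[of r] by eventually_elim (auto simp: Y_nonneg intro!: power_mono)
qed simp

lemma p_eq: "p r = 1 - F r"
proof -
  have "{x \<in> space M. r < X x} = space M - {x \<in> space M. X x \<le> r}" by auto
  then show ?thesis unfolding p_def F_def by (simp add: prob_compl)
qed

lemma F_nonneg: "0 \<le> F r" and p_nonneg: "0 \<le> p r"
  by (auto simp: F_def p_def)

lemma F_pos: "a < r \<Longrightarrow> 0 < F r"
  unfolding F_def by (rule lower_mass)

lemma p_pos: "r < b \<Longrightarrow> 0 < p r"
  unfolding p_def by (rule upper_mass)

lemma F_eq_0: "r \<le> a \<Longrightarrow> F r = 0"
proof -
  assume r: "r \<le> a"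
  \<comment> \<open>At \<open>r = a\<close> the bound \<open>a \<le> X\<close> still allows
    \<open>X = a\<close>, which only the absence of atoms excludes.\<close>
  have "AE x in M. \<not> X x \<le> r"
    using AE_range atomless[of a] by eventually_elim (use r in auto)
  then show ?thesis
    unfolding F_def by (subst prob_eq_0) auto
qed

lemma p_eq_0: "b \<le> r \<Longrightarrow> p r = 0"
proof -
  assume r: "b \<le> r"
  have "AE x in M. \<not> r < X x"
    using AE_range by eventually_elim (use r in auto)
  then show ?thesis
    unfolding p_def by (subst prob_eq_0) auto
qed

lemma a_less_b: "a < b"
proof (rule ccontr)
  assume "\<not> a < b"
  then have "F a = 1" using p_eq_0[of a] p_eq[of a] by simp
  then show False using F_eq_0[of a] by simp
qed

lemma isCont_F: "isCont F r"
proof -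
  interpret D: real_distribution "distr M borel X"
    by (rule real_distribution_distr) simp
  have "F = cdf (distr M borel X)"
  proof
    fix s
    have "X -` {..s} \<inter> space M = {x \<in> space M. X x \<le> s}" by auto
    then show "F s = cdf (distr M borel X) s"
      by (simp add: cdf_def F_def measure_distr)
  qed
  moreover have "isCont (cdf (distr M borel X)) r"
  proof (subst D.isCont_cdf)
    have "X -` {r} \<inter> space M = {x \<in> space M. X x = r}" by auto
    moreover have "prob {x \<in> space M. X x = r} = 0"
      using atomless[of r] by (subst prob_eq_0) auto
    ultimately show "measure (distr M borel X) {r} = 0"
      by (simp add: measure_distr)
  qed
  ultimately show ?thesis by simp
qed

lemma isCont_p: "isCont p r"
proof -
  have "p = (\<lambda>r. 1 - F r)" by (auto simp: p_eq)
  then show ?thesis using isCont_F[of r] by simp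
qed

lemma p_eq_expectation: "p r = expectation (\<lambda>x. indicator {x \<in> space M. r < X x} x)"
  unfolding p_def by simp

section \<open>Derivatives of the excess moments\<close>

lemma DERIV_u: "(u has_real_derivative - p r) (at r)"
proof (rule has_real_derivative_of_remainder)
  let ?I = "\<lambda>r x. indicator {x \<in> space M. r < X x} x :: real"
  have int: "integrable M (?I s)" for s
    by (rule integrable_const_bound[where B = 1]) auto
  fix y
  have "\<bar>u y - u r - - p r * (y - r)\<bar> = \<bar>expectation (\<lambda>x. Y y x - Y r x + (y - r) * ?I r x)\<bar>"
    unfolding u_def p_eq_expectation using int by (simp add: mult.commute)
  \<comment> \<open>For fixed \<open>X\<close>, the excess is convex and piecewise linear in the
    level. Its linearization error is thus nonnegative; it vanishes unless \<open>X\<close> lies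
    between \<open>r\<close> and \<open>y\<close>, and there it is at most the distance of
    \<open>y\<close> from \<open>r\<close>. The bounding integrand is that distance times the
    indicator of this event, and continuity of \<open>p\<close> makes its probability small.\<close>
  also have "\<dots> \<le> expectation (\<lambda>x. (y - r) * (?I r x - ?I y x))"
  proof -
    have "expectation (\<lambda>x. Y y x - Y r x + (y - r) * ?I r x) \<le> expectation (\<lambda>x. (y - r) * (?I r x - ?I y x))"
    proof (rule integral_mono)
      show "Y y x - Y r x + (y - r) * ?I r x \<le> (y - r) * (?I r x - ?I y x)" if "x \<in> space M" for x
        using that by (auto simp: Y_def indicator_def max_def)
    qed (use int in simp_all)
    moreover have "0 \<le> expectation (\<lambda>x. Y y x - Y r x + (y - r) * ?I r x)"
      by (rule integral_nonneg_AE) (auto simp: Y_def indicator_def max_def split: if_splits)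
    ultimately show ?thesis by simp
  qed
  also have "\<dots> = (y - r) * (p r - p y)"
    unfolding p_eq_expectation using int by simp
  also have "\<dots> \<le> \<bar>y - r\<bar> * \<bar>p y - p r\<bar>"
    by (metis abs_ge_self abs_minus_commute abs_mult)
  finally show "\<bar>u y - u r - - p r * (y - r)\<bar> \<le> \<bar>y - r\<bar> * \<bar>p y - p r\<bar>" .
next
  show "((\<lambda>y. \<bar>p y - p r\<bar>) \<longlongrightarrow> 0) (at r)"
    using isCont_p[of r] by (intro tendsto_rabs_zero LIM_zero) (simp add: isCont_def)
qed

lemma DERIV_v: "(v has_real_derivative - 2 * u r) (at r)"
proof (rule has_real_derivative_of_remainder)
  fix y
  \<comment> \<open>The squared excess is convex in the level and its derivative is 2-Lipschitz, so
    the first-order remainder lies between 0 and the squared step.\<close>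
  have pt: "0 \<le> (Y y x)\<^sup>2 - (Y r x)\<^sup>2 + 2 * (y - r) * Y r x"
    "(Y y x)\<^sup>2 - (Y r x)\<^sup>2 + 2 * (y - r) * Y r x \<le> (y - r)\<^sup>2" for x
  proof -
    have *: "(Y y x)\<^sup>2 - (Y r x)\<^sup>2 + 2 * (y - r) * Y r x
      = (if X x \<le> r then (Y y x)\<^sup>2 else if X x \<le> y then (y - r)\<^sup>2 - (y - X x)\<^sup>2 else (y - r)\<^sup>2)"
      by (auto simp: Y_def max_def power2_eq_square algebra_simps)
    show "0 \<le> (Y y x)\<^sup>2 - (Y r x)\<^sup>2 + 2 * (y - r) * Y r x"
      unfolding * by (auto intro!: power_mono)
    have "(Y y x)\<^sup>2 \<le> (y - r)\<^sup>2" if "X x \<le> r"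
      using that by (intro abs_le_square_iff[THEN iffD1]) (auto simp: Y_def)
    then show "(Y y x)\<^sup>2 - (Y r x)\<^sup>2 + 2 * (y - r) * Y r x \<le> (y - r)\<^sup>2"
      unfolding * by auto
  qed
  have "\<bar>v y - v r - - 2 * u r * (y - r)\<bar>
      = \<bar>expectation (\<lambda>x. (Y y x)\<^sup>2 - (Y r x)\<^sup>2 + 2 * (y - r) * Y r x)\<bar>"
    unfolding u_def v_def by (simp add: algebra_simps)
  also have "\<dots> \<le> expectation (\<lambda>x. (y - r)\<^sup>2)"
  proof -
    have "expectation (\<lambda>x. (Y y x)\<^sup>2 - (Y r x)\<^sup>2 + 2 * (y - r) * Y r x) \<le> expectation (\<lambda>x. (y - r)\<^sup>2)"
      by (rule integral_mono) (use pt in auto)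
    moreover have "0 \<le> expectation (\<lambda>x. (Y y x)\<^sup>2 - (Y r x)\<^sup>2 + 2 * (y - r) * Y r x)"
      by (rule integral_nonneg_AE) (use pt in auto)
    ultimately show ?thesis by simp
  qed
  also have "\<dots> = \<bar>y - r\<bar> * \<bar>y - r\<bar>"
    by (simp add: power2_eq_square prob_space)
  finally show "\<bar>v y - v r - - 2 * u r * (y - r)\<bar> \<le> \<bar>y - r\<bar> * \<bar>y - r\<bar>" .
next
  show "((\<lambda>y. \<bar>y - r\<bar>) \<longlongrightarrow> 0) (at r)"
    by (intro tendsto_rabs_zero LIM_zero) simp
qed

section \<open>Variance of the excess and strict inequalities\<close>

lemma DERIV_w: "(w has_real_derivative - 2 * u r * F r) (at r)"
  unfolding w_def
  by (rule derivative_eq_intros DERIV_u DERIV_v refl)+ (simp add: p_eq algebra_simps)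

lemma isCont_u: "isCont u r" and isCont_w: "isCont w r"
  using DERIV_u DERIV_w by (blast intro: DERIV_isCont)+

text \<open>For \<open>r < b\<close> the event \<open>r < X\<close> has positive probability, so a
  constant value of \<open>X\<close> on it would be an atom. All strict inequalities and the
  uniqueness of minimizers rest on this contradiction.\<close>

lemma not_AE_const_above:
  assumes "r < b" "AE x in M. r < X x \<longrightarrow> X x = c"
  shows False
proof -
  have "AE x in M. \<not> r < X x"
    using assms(2) atomless[of c] by eventually_elim auto
  then have "p r = 0"
    unfolding p_def by (subst prob_eq_0) auto
  then show False using p_pos[OF assms(1)] by simp
qed

lemma u_pos: "r < b \<Longrightarrow> 0 < u r"
proof -
  assume r: "r < b"
  have "u r \<noteq> 0"
  proof
    assume "u r = 0"
    then have "AE x in M. Y r x = 0"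
      unfolding u_def by (subst (asm) integral_nonneg_eq_0_iff_AE) (auto simp: Y_nonneg)
    then have "AE x in M. r < X x \<longrightarrow> X x = r"
      by eventually_elim (auto simp: Y_def max_def split: if_splits)
    then show False by (rule not_AE_const_above[OF r])
  qed
  moreover have "0 \<le> u r" unfolding u_def by (rule integral_nonneg_AE) (simp add: Y_nonneg)
  ultimately show ?thesis by simp
qed

text \<open>
  Cauchy--Schwarz on the event \<open>r < X\<close>; strict because \<open>X\<close> is not constant there.
\<close>

lemma u_sq_less: "r < b \<Longrightarrow> (u r)\<^sup>2 < p r * v r"
proof -
  assume r: "r < b"
  let ?I = "\<lambda>x. indicator {x \<in> space M. r < X x} x :: real"
  \<comment> \<open>The mean of \<open>Y r\<close> conditional on \<open>r < X\<close>; it minimizes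
    the quadratic in \<open>c\<close> that appears in \<open>eq\<close>.\<close>
  define c where "c = u r / p r"
  have int: "integrable M ?I"
    by (rule integrable_const_bound[where B = 1]) auto
  have expand: "(Y r x - c * ?I x)\<^sup>2 = (Y r x)\<^sup>2 - 2 * c * Y r x + c\<^sup>2 * ?I x" if "x \<in> space M" for x
    using that by (auto simp: Y_def indicator_def power2_eq_square algebra_simps max_def)
  have eq: "expectation (\<lambda>x. (Y r x - c * ?I x)\<^sup>2) = v r - 2 * c * u r + c\<^sup>2 * p r"
    using int by (subst Bochner_Integration.integral_cong[OF refl expand])
      (auto simp: u_def v_def p_eq_expectation)
  have intsq: "integrable M (\<lambda>x. (Y r x - c * ?I x)\<^sup>2)"
    using int by (subst Bochner_Integration.integrable_cong[OF refl expand]) auto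
  have "expectation (\<lambda>x. (Y r x - c * ?I x)\<^sup>2) \<noteq> 0"
  proof
    assume "expectation (\<lambda>x. (Y r x - c * ?I x)\<^sup>2) = 0"
    then have "AE x in M. (Y r x - c * ?I x)\<^sup>2 = 0"
      using intsq by (subst (asm) integral_nonneg_eq_0_iff_AE) auto
    then have "AE x in M. r < X x \<longrightarrow> X x = r + c"
      using AE_space by eventually_elim (auto simp: Y_def)
    then show False by (rule not_AE_const_above[OF r])
  qed
  moreover have "0 \<le> expectation (\<lambda>x. (Y r x - c * ?I x)\<^sup>2)"
    by (rule integral_nonneg_AE) simp
  ultimately have "0 < v r - 2 * c * u r + c\<^sup>2 * p r" using eq by simp
  also have "\<dots> = v r - (u r)\<^sup>2 / p r"
    using p_pos[OF r] by (simp add: c_def power2_eq_square field_simps)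
  finally show ?thesis using p_pos[OF r] by (simp add: field_simps)
qed

lemma v_nonneg: "0 \<le> v r"
  unfolding v_def by (rule integral_nonneg_AE) simp

lemma u_v_eq_0: assumes "b \<le> r" shows "u r = 0" "v r = 0" "w r = 0" "h r = 0"
proof -
  have ae: "AE x in M. Y r x = 0"
    using AE_range by eventually_elim (use assms in \<open>auto simp: Y_def\<close>)
  then show "u r = 0" unfolding u_def by (simp add: integral_eq_zero_AE)
  moreover have "AE x in M. (Y r x)\<^sup>2 = 0" using ae by eventually_elim simp
  then show "v r = 0" unfolding v_def by (simp add: integral_eq_zero_AE)
  ultimately show "w r = 0" "h r = 0" by (simp_all add: w_def h_def)
qed

text \<open>Cauchy--Schwarz in the form \<open>w \<ge> v - p v\<close>. The bound is relative to
  \<open>v\<close>, hence still informative near \<open>b\<close>, where \<open>v\<close> and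
  \<open>w\<close> both tend to 0.\<close>

lemma w_ge: "F r * v r \<le> w r"
proof (cases "r < b")
  case True
  then show ?thesis using u_sq_less[of r] by (simp add: w_def p_eq algebra_simps)
next
  case False
  then show ?thesis using u_v_eq_0[of r] by simp
qed

lemma w_pos: "r < b \<Longrightarrow> 0 < w r"
proof -
  assume r: "r < b"
  have "p r * v r \<le> v r"
    using F_nonneg[of r] p_nonneg[of r] v_nonneg[of r] p_eq[of r] by (simp add: mult_left_le_one_le)
  then show ?thesis using u_sq_less[OF r] by (simp add: w_def)
qed

lemma w_nonneg: "0 \<le> w r"
  using w_pos[of r] u_v_eq_0(3)[of r] by (cases "r < b") auto

section \<open>Monotonicity and continuity of the ratio \<open>h\<close>\<close>

lemma h_pos: "r < b \<Longrightarrow> 0 < h r"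
  by (simp add: h_def u_pos w_pos)

text \<open>Squaring removes the root: left of \<open>b\<close>, the derivative of the square of
  \<open>h\<close> has the sign of \<open>u^2 - p v\<close>, negative by \<open>u_sq_less\<close>.
  The end point \<open>s = b\<close>, where \<open>w\<close> vanishes, is settled by positivity of
  \<open>h\<close> to its left.\<close>

lemma h_strict_antimono:
  assumes "r < s" "s \<le> b" shows "h s < h r"
proof (cases "s < b")
  case False
  then show ?thesis using assms h_pos[of r] u_v_eq_0(4)[of s] by simp
next
  case True
  have "(u s)\<^sup>2 / w s < (u r)\<^sup>2 / w r"
  proof (rule DERIV_neg_imp_decreasing[OF assms(1)])
    fix x assume "r \<le> x" "x \<le> s"
    then have x: "x < b" using True by simp
    have "((\<lambda>r. (u r)\<^sup>2 / w r) has_real_derivative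
        2 * u x * ((u x)\<^sup>2 - p x * v x) / (w x)\<^sup>2) (at x)"
      using w_pos[OF x]
      by (auto intro!: derivative_eq_intros DERIV_u DERIV_w simp: power2_eq_square)
         (simp add: w_def p_eq power2_eq_square algebra_simps)
    moreover have "2 * u x * ((u x)\<^sup>2 - p x * v x) / (w x)\<^sup>2 < 0"
      using u_pos[OF x] w_pos[OF x] u_sq_less[OF x]
      by (intro divide_neg_pos mult_pos_neg) auto
    ultimately show "\<exists>y. ((\<lambda>r. (u r)\<^sup>2 / w r) has_real_derivative y) (at x) \<and> y < 0" by blast
  qed
  then have "sqrt ((u s)\<^sup>2 / w s) < sqrt ((u r)\<^sup>2 / w r)" by simp
  then show ?thesis
    using True assms u_pos[of s] u_pos[of r] by (simp add: h_def real_sqrt_divide)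
qed

text \<open>These bounds resolve the indeterminate quotient at \<open>b\<close> by squeezing: there
  \<open>p\<close> tends to 0 and \<open>F\<close> to 1.\<close>

lemma h_bounds:
  assumes "a < r" shows "0 \<le> h r" "h r \<le> sqrt (p r / F r)"
proof -
  show "0 \<le> h r" using h_pos[of r] u_v_eq_0(4)[of r] by (cases "r < b") auto
  show "h r \<le> sqrt (p r / F r)"
  proof (cases "r < b")
    case False
    then show ?thesis using u_v_eq_0(4)[of r] p_nonneg F_nonneg by simp
  next
    case True
    have "(u r)\<^sup>2 * F r \<le> p r * v r * F r"
      using u_sq_less[OF True] F_nonneg by (intro mult_right_mono) auto
    also have "\<dots> \<le> p r * w r"
      using w_ge[of r] p_nonneg[of r] by (simp add: mult_left_mono mult.assoc mult.commute[of "v r"])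
    finally have "(u r)\<^sup>2 / w r \<le> p r / F r"
      using F_pos[OF assms] w_pos[OF True] by (simp add: field_simps)
    then have "sqrt ((u r)\<^sup>2 / w r) \<le> sqrt (p r / F r)" by simp
    then show ?thesis using u_pos[OF True] by (simp add: h_def real_sqrt_divide)
  qed
qed

lemma isCont_h: "isCont h r"
proof (cases r b rule: linorder_cases)
  case less
  then have "sqrt (w r) \<noteq> 0" using w_pos[of r] by simp
  then show ?thesis unfolding h_def
    using isCont_u isCont_w by (intro continuous_intros) auto
next
  case equal
  have "F b = 1" "p b = 0" using p_eq[of b] p_eq_0[of b] by auto
  then have "((\<lambda>r. sqrt (p r / F r)) \<longlongrightarrow> sqrt (0 / 1)) (at b)"
    using isCont_p[of b] isCont_F[of b]
    by (intro tendsto_intros) (auto simp: isCont_def)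
  then have lim: "((\<lambda>r. sqrt (p r / F r)) \<longlongrightarrow> 0) (at b)" by simp
  have ev: "\<forall>\<^sub>F r in at b. a < r"
    using a_less_b by (intro order_tendstoD(1)[OF tendsto_ident_at])
  have "(h \<longlongrightarrow> 0) (at b)"
    by (rule real_tendsto_sandwich[OF _ _ tendsto_const lim])
       (use ev in \<open>eventually_elim, simp add: h_bounds\<close>)+
  then show ?thesis using equal u_v_eq_0(4)[of b] by (simp add: isCont_def)
next
  case greater
  have "\<forall>\<^sub>F s in nhds r. h s = 0"
    using eventually_nhds_in_open[of "{b<..}" r] greater
    by (auto elim!: eventually_mono simp: u_v_eq_0)
  then show ?thesis by (subst isCont_cong) auto
qed

section \<open>The derivative of the standard deviation and of \<open>J\<close>\<close>

lemma sqrt_w_le: "r \<le> b \<Longrightarrow> sqrt (w r) \<le> (b - r) * sqrt (p r)"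
proof -
  assume r: "r \<le> b"
  let ?I = "\<lambda>x. indicator {x \<in> space M. r < X x} x :: real"
  have int: "integrable M ?I"
    by (rule integrable_const_bound[where B = 1]) auto
  have "v r \<le> expectation (\<lambda>x. (b - r)\<^sup>2 * ?I x)"
    unfolding v_def
  proof (rule integral_mono_AE)
    show "AE x in M. (Y r x)\<^sup>2 \<le> (b - r)\<^sup>2 * ?I x"
      using AE_range AE_space
      by eventually_elim (auto simp: Y_def max_def intro!: power_mono)
  qed (use int in auto)
  also have "\<dots> = (b - r)\<^sup>2 * p r" using int by (simp add: p_eq_expectation)
  finally have "w r \<le> (b - r)\<^sup>2 * p r" by (simp add: w_def add_increasing2 order_trans[rotated])
  then have "sqrt (w r) \<le> sqrt ((b - r)\<^sup>2 * p r)" by simp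
  then show ?thesis using r by (simp add: real_sqrt_mult)
qed

text \<open>The chain rule fails at \<open>b\<close>, where the root is taken at 0. There
  \<open>sqrt_w_le\<close> bounds the difference by the step times \<open>sqrt (p y)\<close>, which
  tends to 0, so the derivative is 0.\<close>

lemma DERIV_sqrt_w: "((\<lambda>r. sqrt (w r)) has_real_derivative - (F r * h r)) (at r)"
proof (cases r b rule: linorder_cases)
  case less
  have "((\<lambda>r. sqrt (w r)) has_real_derivative
      inverse (sqrt (w r)) / 2 * (- 2 * u r * F r)) (at r)"
    by (rule DERIV_chain2[OF DERIV_real_sqrt[OF w_pos[OF less]] DERIV_w])
  then show ?thesis by (simp add: h_def field_simps)
next
  case equal
  have "((\<lambda>r. sqrt (w r)) has_real_derivative 0) (at b)"
  proof (rule has_real_derivative_of_remainder)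
    fix y
    show "\<bar>sqrt (w y) - sqrt (w b) - 0 * (y - b)\<bar> \<le> \<bar>y - b\<bar> * sqrt (p y)"
      using sqrt_w_le[of y] u_v_eq_0(3)[of b] u_v_eq_0(3)[of y] w_nonneg[of y] p_nonneg[of y]
      by (cases "y \<le> b") auto
  next
    have "((\<lambda>y. sqrt (p y)) \<longlongrightarrow> sqrt (p b)) (at b)"
      using isCont_p[of b] by (intro tendsto_intros) (simp add: isCont_def)
    then show "((\<lambda>y. sqrt (p y)) \<longlongrightarrow> 0) (at b)" by (simp add: p_eq_0)
  qed
  then show ?thesis using equal u_v_eq_0(4)[of b] by simp
next
  case greater
  have "\<forall>\<^sub>F s in nhds r. sqrt (w s) = 0"
    using eventually_nhds_in_open[of "{b<..}" r] greater
    by (auto elim!: eventually_mono simp: u_v_eq_0)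
  then have "((\<lambda>r. sqrt (w r)) has_real_derivative 0) (at r)"
    by (subst DERIV_cong_ev[OF refl _ refl, where g = "\<lambda>_. 0"]) auto
  then show ?thesis using greater by (simp add: u_v_eq_0)
qed

lemma expectation_max: "expectation (\<lambda>x. max (X x) r) = r + u r"
  by (simp add: max_eq_Y u_def prob_space)

lemma std_dev_max: "std_dev M (\<lambda>x. max (X x) r) = sqrt (w r)"
proof -
  have "variance (\<lambda>x. max (X x) r) = variance (Y r)"
    by (simp add: max_eq_Y prob_space)
  also have "\<dots> = w r"
    by (simp add: variance_eq w_def v_def u_def)
  finally show ?thesis by (simp add: std_dev_def)
qed

lemma J_eq: "J \<alpha> M X r = \<alpha> * (r + u r) + (1 - \<alpha>) * sqrt (w r)"
  by (simp add: J_def expectation_max std_dev_max)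

lemma DERIV_J: "(J \<alpha> M X has_real_derivative F r * (\<alpha> - (1 - \<alpha>) * h r)) (at r)"
proof -
  have "((\<lambda>r. \<alpha> * (r + u r) + (1 - \<alpha>) * sqrt (w r)) has_real_derivative
      \<alpha> * (1 + - p r) + (1 - \<alpha>) * - (F r * h r)) (at r)"
    by (intro DERIV_add DERIV_cmult DERIV_ident DERIV_u DERIV_sqrt_w)
  then show ?thesis by (simp add: J_eq[abs_def] p_eq algebra_simps)
qed

lemma deriv_J: "deriv (J \<alpha> M X) r = F r * (\<alpha> - (1 - \<alpha>) * h r)"
  by (rule DERIV_imp_deriv[OF DERIV_J])

section \<open>The root of \<open>J'\<close>\<close>

lemma AE_max_a: "AE x in M. max a (X x) = X x"
  using AE_range by eventually_elim auto

lemma integrable_X: "integrable M X"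
proof (rule integrable_const_bound)
  show "AE x in M. norm (X x) \<le> max \<bar>a\<bar> \<bar>b\<bar>"
    using AE_range by eventually_elim auto
qed simp

lemma expectation_X: "expectation X = a + u a"
proof -
  have "expectation X = expectation (\<lambda>x. max (X x) a)"
    by (rule integral_cong_AE) (use AE_max_a in \<open>auto simp: max.commute\<close>)
  then show ?thesis by (simp add: expectation_max)
qed

text \<open>Truncation at \<open>a\<close> changes \<open>X\<close> only on a null set, so
  \<open>u a\<close> and \<open>sqrt (w a)\<close> are the mean above \<open>a\<close> and the
  standard deviation of \<open>X\<close>. The two conditions differ by the positive factor
  \<open>sqrt (w a)\<close>.\<close>

lemma nontrivial_threshold_iff:
  "nontrivial_threshold \<alpha> M X a \<longleftrightarrow> \<alpha> - (1 - \<alpha>) * h a < 0"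
proof -
  note E = expectation_X
  have "variance X = variance (\<lambda>x. max (X x) a)"
    unfolding E expectation_max
    by (rule integral_cong_AE) (use AE_max_a in \<open>auto simp: max.commute\<close>)
  then have "std_dev M X = sqrt (w a)"
    using std_dev_max[of a] by (simp add: std_dev_def)
  then show ?thesis
    using E w_pos[OF a_less_b] by (simp add: nontrivial_threshold_def h_def field_simps)
qed

text \<open>For \<alpha> < 1 the second factor of \<open>J'\<close> increases strictly on
  \<open>[a, b]\<close> and equals \<alpha> at \<open>b\<close>. If it is negative at
  \<open>a\<close>, the intermediate value theorem gives its root, which is \<open>b\<close> when
  \<alpha> = 0. Otherwise \<alpha> > 0, the factor has no root right of \<open>a\<close>, and
  \<open>rs = a\<close>.\<close>

lemma threshold_exists:
  assumes "0 \<le> \<alpha>" "\<alpha> \<le> 1"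
  obtains rs where "a \<le> rs" "rs \<le> b" "0 \<le> \<alpha> - (1 - \<alpha>) * h rs"
    "a < rs \<Longrightarrow> \<alpha> - (1 - \<alpha>) * h rs = 0"
    "0 < \<alpha> \<Longrightarrow> rs < b" "\<alpha> = 0 \<Longrightarrow> rs = b"
    "\<And>r. a < r \<Longrightarrow> r \<le> b \<Longrightarrow> \<alpha> - (1 - \<alpha>) * h r = 0 \<Longrightarrow> r = rs"
    "a < rs \<longleftrightarrow> \<alpha> - (1 - \<alpha>) * h a < 0"
proof -
  let ?G = "\<lambda>r. \<alpha> - (1 - \<alpha>) * h r"
  have mono: "?G r < ?G s" if "r < s" "s \<le> b" "\<alpha> < 1" for r s
    using h_strict_antimono[OF that(1,2)] that(3) by simp
  have Gb: "?G b = \<alpha>" by (simp add: u_v_eq_0)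
  show thesis
  proof (cases "?G a < 0")
    case True
    then have a1: "\<alpha> < 1" using assms by (cases "\<alpha> = 1") auto
    have "\<exists>r\<ge>a. r \<le> b \<and> ?G r = 0"
      using True Gb assms a_less_b isCont_h
      by (intro IVT) (auto intro!: continuous_intros)
    then obtain rs where rs: "a \<le> rs" "rs \<le> b" "?G rs = 0" by blast
    have uniq: "r = rs" if "r \<le> b" "?G r = 0" for r
      using mono[of r rs] mono[of rs r] that rs a1 by (cases r rs rule: linorder_cases) auto
    have "a < rs" using rs True by (cases "a = rs") auto
    moreover have "rs < b" if "0 < \<alpha>" using that rs Gb by (cases "rs = b") auto
    moreover have "rs = b" if "\<alpha> = 0" using uniq[of b] that Gb by simp
    ultimately show thesis
      by (intro that[of rs] uniq rs(1,2)) (simp_all only: True rs(3) order_refl)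
  next
    case False
    have "0 < \<alpha>"
    proof (rule ccontr)
      assume "\<not> 0 < \<alpha>"
      then have "\<alpha> = 0" using assms by simp
      then show False using False h_pos[OF a_less_b] by simp
    qed
    moreover have "?G r \<noteq> 0" if "a < r" "r \<le> b" for r
    proof (cases "\<alpha> = 1")
      case False
      then show ?thesis using mono[OF that] \<open>\<not> ?G a < 0\<close> assms by linarith
    qed simp
    ultimately show thesis
      by (intro that[of a]) (use False a_less_b in \<open>simp_all add: less_imp_le\<close>)
  qed
qed

section \<open>Linearization of the cost\<close>

lemma cost_max: "cost \<alpha> M (\<lambda>x. max r (X x)) = ereal (J \<alpha> M X r)"
proof -
  have "(\<lambda>x. (max (X x) r)\<^sup>2) = (\<lambda>x. r\<^sup>2 + 2 * r * Y r x + (Y r x)\<^sup>2)"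
    by (auto simp: max_eq_Y power2_eq_square algebra_simps)
  moreover have "integrable M (\<lambda>x. max (X x) r)"
    by (simp add: max_eq_Y)
  ultimately show ?thesis
    by (simp add: cost_def ext_expectation_def ext_std_dev_def J_def max.commute)
qed

text \<open>
  The linearization of the cost at \<open>max r X\<close>: its integral against \<open>T - max r X\<close> is the first-order
  part of the cost difference. Its constant term is \<open>J' r / F r\<close>.
\<close>

definition gap_weight :: "real \<Rightarrow> real \<Rightarrow> 'x \<Rightarrow> real" where
  "gap_weight \<alpha> r x = (\<alpha> - (1 - \<alpha>) * h r) + (1 - \<alpha>) / sqrt (w r) * Y r x"

text \<open>With \<open>d = (1 - \<alpha>) / sqrt (w r)\<close> the weight is
  \<open>\<alpha> + d * (Y r - u r)\<close>. Integrated against \<open>T - max X r\<close> it yields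
  \<alpha> times the difference of means plus \<open>d\<close> times
  \<open>covariance M T (Y r) - w r\<close>, and \<open>d * w r\<close> is the deviation term of
  \<open>J\<close>.\<close>

lemma gap_identity:
  assumes [measurable]: "T \<in> borel_measurable M" and T2: "integrable M (\<lambda>x. (T x)\<^sup>2)" and "r < b"
  shows "\<alpha> * expectation T + (1 - \<alpha>) * std_dev M T - J \<alpha> M X r
      = expectation (\<lambda>x. (T x - max (X x) r) * gap_weight \<alpha> r x)
        + (1 - \<alpha>) * (std_dev M T - covariance M T (Y r) / sqrt (w r))"
    and "integrable M (\<lambda>x. (T x - max (X x) r) * gap_weight \<alpha> r x)"
proof -
  have T1 [simp]: "integrable M T"
    using T2 by (auto intro: square_integrable_imp_integrable)
  have TY [simp]: "integrable M (\<lambda>x. T x * Y r x)"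
    by (rule integrable_mult_of_squares) (use T2 in auto)
  define d where "d = (1 - \<alpha>) / sqrt (w r)"
  define g where "g = \<alpha> - (1 - \<alpha>) * h r"
  have expand: "(T x - max (X x) r) * gap_weight \<alpha> r x
      = g * T x - g * r - (g + d * r) * Y r x + d * (T x * Y r x) - d * (Y r x)\<^sup>2" for x
    unfolding gap_weight_def max_eq_Y d_def[symmetric] g_def[symmetric]
    by (simp add: power2_eq_square algebra_simps)
  show "integrable M (\<lambda>x. (T x - max (X x) r) * gap_weight \<alpha> r x)"
    unfolding expand by simp
  have E: "expectation (\<lambda>x. (T x - max (X x) r) * gap_weight \<alpha> r x)
      = g * expectation T - g * r - (g + d * r) * u r + d * expectation (\<lambda>x. T x * Y r x) - d * v r"
    unfolding expand by (simp add: u_def v_def prob_space)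
  have "covariance M T (Y r) = expectation (\<lambda>x. T x * Y r x) - expectation T * u r"
    unfolding u_def by (rule covariance_eq) (use T2 in auto)
  moreover have "w r = sqrt (w r) * sqrt (w r)" "0 < sqrt (w r)" using w_pos[OF \<open>r < b\<close>] by auto
  then have "(1 - \<alpha>) * sqrt (w r) = d * (v r - (u r)\<^sup>2)" "g = \<alpha> - d * u r"
    unfolding w_def[symmetric] by (auto simp: d_def g_def h_def field_simps)
  moreover have "(1 - \<alpha>) * (std_dev M T - covariance M T (Y r) / sqrt (w r))
      = (1 - \<alpha>) * std_dev M T - d * covariance M T (Y r)"
    by (simp add: d_def right_diff_distrib)
  ultimately show "\<alpha> * expectation T + (1 - \<alpha>) * std_dev M T - J \<alpha> M X r
      = expectation (\<lambda>x. (T x - max (X x) r) * gap_weight \<alpha> r x)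
        + (1 - \<alpha>) * (std_dev M T - covariance M T (Y r) / sqrt (w r))"
    unfolding E J_eq by (simp only: power2_eq_square) (simp only: algebra_simps)
qed

lemma variance_Y: "variance (Y r) = w r"
  by (simp add: variance_eq w_def v_def u_def)

section \<open>Optimality and uniqueness of the minimizer\<close>

context
  fixes \<alpha> rs :: real and T :: "'x \<Rightarrow> real"
  assumes \<alpha>: "0 \<le> \<alpha>" "\<alpha> \<le> 1"
    and rs: "a \<le> rs" "rs \<le> b" "0 < \<alpha> \<Longrightarrow> rs < b" "\<alpha> = 0 \<Longrightarrow> rs = b"
    and slope: "0 \<le> \<alpha> - (1 - \<alpha>) * h rs" "a < rs \<Longrightarrow> \<alpha> - (1 - \<alpha>) * h rs = 0"
    and adm: "admissible M X T"
begin

lemma T_measurable [measurable]: "T \<in> borel_measurable M"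
  and T_ge: "x \<in> space M \<Longrightarrow> X x \<le> T x"
  using adm by (auto simp: admissible_def)

lemma AE_gap_nonneg: "AE x in M. 0 \<le> (T x - max (X x) rs) * gap_weight \<alpha> rs x"
  using AE_range AE_space
proof eventually_elim
  case (elim x)
  have "0 \<le> gap_weight \<alpha> rs x"
    using \<alpha> slope(1) w_nonneg[of rs] Y_nonneg[of rs x] by (simp add: gap_weight_def)
  moreover have "gap_weight \<alpha> rs x = 0 \<or> max (X x) rs \<le> T x"
  \<comment> \<open>In the first case \<open>max X rs\<close> equals \<open>X\<close>, which
    \<open>T\<close> dominates. In the second \<open>Y rs\<close> vanishes and
    \<open>a < rs\<close>, so the weight reduces to the second factor of \<open>J'\<close> at its
    root.\<close>
  proof (cases "rs < X x \<or> rs = a")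
    case True
    then show ?thesis using elim T_ge[of x] by (auto simp: max_def)
  next
    case False
    then show ?thesis using slope(2) rs(1) by (simp add: gap_weight_def Y_def)
  qed
  ultimately show ?case by auto
qed

lemma covariance_le_std_dev:
  assumes "integrable M (\<lambda>x. (T x)\<^sup>2)" "rs < b"
  shows "covariance M T (Y rs) / sqrt (w rs) \<le> std_dev M T"
proof -
  have "covariance M T (Y rs) \<le> std_dev M T * sqrt (w rs)"
    unfolding std_dev_def variance_Y[symmetric]
    by (rule covariance_le) (simp_all only: T_measurable Y_measurable assms(1) integrable_Y_sq variance_Y w_pos[OF assms(2)])
  then show ?thesis
    using w_pos[OF assms(2)] by (simp add: pos_divide_le_eq)
qed

lemma cost_interior:
  assumes "0 < \<alpha>" "\<alpha> < 1"
  shows "cost \<alpha> M T = (if integrable M (\<lambda>x. (T x)\<^sup>2)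
     then ereal (\<alpha> * expectation T + (1 - \<alpha>) * std_dev M T) else \<infinity>)"
proof (cases "integrable M (\<lambda>x. (T x)\<^sup>2)")
  case True
  then have "integrable M T" by (rule square_integrable_imp_integrable[OF T_measurable])
  with True show ?thesis by (simp add: cost_def ext_expectation_def ext_std_dev_def)
next
  case False
  then show ?thesis using assms by (simp add: cost_def ext_expectation_def ext_std_dev_def)
qed

lemma AE_eq_expectation_of_std_dev_0:
  assumes "integrable M (\<lambda>x. (T x)\<^sup>2)" "std_dev M T = 0"
  shows "AE x in M. T x = expectation T"
  using assms by (intro AE_eq_expectation) (auto simp: std_dev_def)

lemma cost_max_le: "cost \<alpha> M (\<lambda>x. max rs (X x)) \<le> cost \<alpha> M T"
proof -
  consider "\<alpha> = 0" | "\<alpha> = 1" | "0 < \<alpha>" "\<alpha> < 1" using \<alpha> by linarith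
  then show ?thesis
  proof cases
    case 1
    \<comment> \<open>Here \<open>rs = b\<close> and \<open>max b X\<close> is almost surely
      constant, so the candidate has cost 0.\<close>
    have "0 \<le> ext_std_dev M T"
      using variance_positive[of T] by (simp add: ext_std_dev_def std_dev_def)
    then have "0 \<le> cost \<alpha> M T"
      using 1 by (simp add: cost_def zero_ereal_def[symmetric])
    then show ?thesis
      using 1 rs(4) by (simp add: cost_max J_eq u_v_eq_0 zero_ereal_def[symmetric])
  next
    case 2
    then have "rs = a" using slope(2) rs(1) by (cases "a < rs") auto
    have X: "integrable M X" "expectation X = a + u a"
      using integrable_X expectation_X by auto
    have "a + u a \<le> expectation T" if "integrable M T"
      unfolding X(2)[symmetric] by (rule integral_mono) (use that X(1) T_ge in auto)
    then show ?thesis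
      unfolding cost_max
      using 2 \<open>rs = a\<close> by (simp add: J_eq cost_def ext_expectation_def zero_ereal_def[symmetric])
  next
    case 3
    have "rs < b" using rs(3) 3 by simp
    have "J \<alpha> M X rs \<le> \<alpha> * expectation T + (1 - \<alpha>) * std_dev M T"
      if T2: "integrable M (\<lambda>x. (T x)\<^sup>2)"
    proof -
      have "0 \<le> expectation (\<lambda>x. (T x - max (X x) rs) * gap_weight \<alpha> rs x)"
        by (rule integral_nonneg_AE[OF AE_gap_nonneg])
      moreover have "0 \<le> (1 - \<alpha>) * (std_dev M T - covariance M T (Y rs) / sqrt (w rs))"
        using 3 covariance_le_std_dev[OF T2 \<open>rs < b\<close>] by simp
      ultimately show ?thesis
        using gap_identity(1)[OF T_measurable T2 \<open>rs < b\<close>, of \<alpha>] by linarith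
    qed
    then show ?thesis using cost_interior[OF 3] by (simp add: cost_max)
  qed
qed

text \<open>Both summands of the gap identity are nonnegative, so both vanish. The first fixes
  \<open>T\<close> above \<open>rs\<close>; the second makes \<open>T\<close> affine in
  \<open>Y rs\<close>, which carries this information to the rest of the space.\<close>

lemma minimizer_interior:
  assumes a: "0 < \<alpha>" "\<alpha> < 1" and le: "cost \<alpha> M T \<le> ereal (J \<alpha> M X rs)"
  shows "AE x in M. T x = max rs (X x)"
proof -
  have "rs < b" using rs(3) a by simp
  have T2: "integrable M (\<lambda>x. (T x)\<^sup>2)"
    and le': "\<alpha> * expectation T + (1 - \<alpha>) * std_dev M T \<le> J \<alpha> M X rs"
    using le cost_interior[OF a] by (auto split: if_splits)
  let ?g = "\<lambda>x. (T x - max (X x) rs) * gap_weight \<alpha> rs x"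
  have "0 \<le> expectation ?g"
    by (rule integral_nonneg_AE[OF AE_gap_nonneg])
  moreover have cov: "0 \<le> std_dev M T - covariance M T (Y rs) / sqrt (w rs)"
    using covariance_le_std_dev[OF T2 \<open>rs < b\<close>] by simp
  moreover have "0 \<le> (1 - \<alpha>) * (std_dev M T - covariance M T (Y rs) / sqrt (w rs))"
    using cov a by simp
  ultimately have "expectation ?g = 0"
    and "(1 - \<alpha>) * (std_dev M T - covariance M T (Y rs) / sqrt (w rs)) = 0"
    using gap_identity(1)[OF T_measurable T2 \<open>rs < b\<close>, of \<alpha>] le' by linarith+
  then have g0: "AE x in M. ?g x = 0"
    and "std_dev M T = covariance M T (Y rs) / sqrt (w rs)"
    using a AE_gap_nonneg gap_identity(2)[OF T_measurable T2 \<open>rs < b\<close>, of \<alpha>]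
    by (auto simp: integral_nonneg_eq_0_iff_AE)
  then have "covariance M T (Y rs) = sqrt (variance T) * sqrt (variance (Y rs))"
    using w_pos[OF \<open>rs < b\<close>] by (simp add: std_dev_def variance_Y)
  then obtain l where l: "AE x in M. T x - expectation T = l * (Y rs x - expectation (Y rs))"
    using covariance_eq_imp_AE_affine[of T "Y rs"] T2 w_pos[OF \<open>rs < b\<close>] by (auto simp: variance_Y)
  have above: "AE x in M. rs < X x \<longrightarrow> T x = X x"
    using g0
  proof eventually_elim
    case (elim x)
    show ?case
    proof
      assume x: "rs < X x"
      have "0 < (1 - \<alpha>) / sqrt (w rs) * Y rs x"
        using x a w_pos[OF \<open>rs < b\<close>] by (simp add: Y_def)
      then have "gap_weight \<alpha> rs x \<noteq> 0" using slope(1) by (simp add: gap_weight_def)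
      then show "T x = X x" using elim x by simp
    qed
  qed
  \<comment> \<open>Comparing the two descriptions of \<open>T\<close> on \<open>rs < X\<close>
    gives a linear equation for \<open>X\<close>. As \<open>X\<close> is not constant there, both
    sides must vanish identically.\<close>
  have eq: "AE x in M. rs < X x \<longrightarrow> (1 - l) * X x = expectation T - l * rs - l * u rs"
    using above l
    by eventually_elim (auto simp: Y_def u_def algebra_simps)
  have "l = 1"
  proof (rule ccontr)
    assume "l \<noteq> 1"
    then have "AE x in M. rs < X x \<longrightarrow> X x = (expectation T - l * rs - l * u rs) / (1 - l)"
      using eq by eventually_elim (use \<open>l \<noteq> 1\<close> in \<open>simp add: eq_divide_eq mult.commute\<close>)
    then show False by (rule not_AE_const_above[OF \<open>rs < b\<close>])
  qed
  have "expectation T = rs + u rs"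
  proof (rule ccontr)
    assume "expectation T \<noteq> rs + u rs"
    \<comment> \<open>The equation is now contradictory, so the event is null and the constant 0 is
      arbitrary.\<close>
    then have "AE x in M. rs < X x \<longrightarrow> X x = 0"
      using eq by eventually_elim (use \<open>l = 1\<close> \<open>expectation T \<noteq> rs + u rs\<close> in auto)
    then show False by (rule not_AE_const_above[OF \<open>rs < b\<close>])
  qed
  with \<open>l = 1\<close> have "AE x in M. T x = rs + Y rs x"
    using l by (simp add: u_def algebra_simps)
  then show ?thesis
    by (simp add: max_eq_Y max.commute[of rs])
qed

text \<open>The threshold is existential because of \<alpha> = 0: a minimizer is then almost surely
  a constant, which can be any value from \<open>b\<close> upwards, and \<open>J'\<close> vanishes
  at all of them.\<close>

lemma minimizer_unique:
  assumes le: "cost \<alpha> M T \<le> ereal (J \<alpha> M X rs)"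
  shows "\<exists>r. deriv (J \<alpha> M X) r = 0 \<and> (0 < \<alpha> \<longrightarrow> r = rs) \<and> (AE x in M. T x = max r (X x))"
proof -
  have rs0: "deriv (J \<alpha> M X) rs = 0"
    using slope(2) rs(1) F_eq_0[of a] by (cases "a < rs") (auto simp: deriv_J)
  consider "\<alpha> = 0" | "\<alpha> = 1" | "0 < \<alpha>" "\<alpha> < 1" using \<alpha> by linarith
  then show ?thesis
  proof cases
    case 1
    define c where "c = expectation T"
    have T2: "integrable M (\<lambda>x. (T x)\<^sup>2)" and "std_dev M T \<le> 0"
      using le 1 rs(4)
      by (auto simp: cost_def J_eq u_v_eq_0 ext_std_dev_def zero_ereal_def[symmetric] split: if_splits)
    then have "std_dev M T = 0" using variance_positive[of T] by (simp add: std_dev_def)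
    then have T: "AE x in M. T x = c"
      unfolding c_def by (rule AE_eq_expectation_of_std_dev_0[OF T2])
    then have "AE x in M. X x \<le> c"
      using AE_space by eventually_elim (use T_ge in force)
    moreover have "b \<le> c"
    proof (rule ccontr)
      assume "\<not> b \<le> c"
      moreover have "AE x in M. c < X x \<longrightarrow> X x = c"
        using \<open>AE x in M. X x \<le> c\<close> by eventually_elim auto
      ultimately show False using not_AE_const_above[of c c] by simp
    qed
    ultimately have "deriv (J \<alpha> M X) c = 0" "AE x in M. T x = max c (X x)"
      using 1 T by (auto simp: deriv_J u_v_eq_0)
    then show ?thesis using 1 by auto
  next
    case 2
    then have "rs = a" using slope(2) rs(1) by (cases "a < rs") auto
    have T1: "integrable M T" and "expectation T \<le> expectation X"
      using le 2 \<open>rs = a\<close>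
      by (auto simp: cost_def J_eq ext_expectation_def expectation_X zero_ereal_def[symmetric] split: if_splits)
    moreover have "0 \<le> expectation (\<lambda>x. T x - X x)"
      by (rule integral_nonneg_AE) (use T_ge in auto)
    ultimately have "expectation (\<lambda>x. T x - X x) = 0"
      using integrable_X by simp
    then have "AE x in M. T x - X x = 0"
      using T1 integrable_X T_ge by (subst (asm) integral_nonneg_eq_0_iff_AE) auto
    then have "AE x in M. T x = max rs (X x)"
      using AE_max_a by eventually_elim (use \<open>rs = a\<close> in auto)
    then show ?thesis using rs0 by auto
  next
    case 3
    then show ?thesis using minimizer_interior[OF 3 le] rs0 by auto
  qed
qed

end

end

section \<open>From a density to the abstract setting, and the final result\<close>

lemma bounded_atomless_rv_distributed:
  assumes "prob_space M" and X: "distributed M lborel X (\<lambda>t. ennreal (\<phi> t))"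
    and nonneg: "\<forall>t. 0 \<le> \<phi> t" and supp: "supported_on \<phi> a b"
  shows "bounded_atomless_rv M X a b"
proof -
  interpret prob_space M by fact
  have [measurable]: "X \<in> borel_measurable M"
    using distributed_measurable[OF X] by simp
  have [measurable]: "(\<lambda>t. ennreal (\<phi> t)) \<in> borel_measurable borel"
    using distributed_borel_measurable[OF X] by simp
  have em: "emeasure M {x \<in> space M. X x \<in> A} = (\<integral>\<^sup>+t\<in>A. ennreal (\<phi> t) \<partial>lborel)"
    if "A \<in> sets borel" for A
  proof -
    have "{x \<in> space M. X x \<in> A} = X -` A \<inter> space M" by auto
    then show ?thesis using distributed_emeasure[OF X, of A] that by simp
  qed
  have null: "AE x in M. X x \<notin> A"
    if A: "A \<in> sets borel" and "AE t in lborel. t \<in> A \<longrightarrow> \<phi> t = 0" for A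
  proof -
    have "(\<integral>\<^sup>+t\<in>A. ennreal (\<phi> t) \<partial>lborel) = (\<integral>\<^sup>+(t::real). 0 \<partial>lborel)"
      by (rule nn_integral_cong_AE) (use that(2) in eventually_elim, auto simp: indicator_def)
    then have "emeasure M {x \<in> space M. X x \<in> A} = 0" using em[OF A] by simp
    then show ?thesis using A by (subst AE_iff_measurable[OF _ refl]) auto
  qed
  have atom: "AE x in M. X x \<noteq> c" for c
  proof -
    have "AE t in lborel. t \<in> {c} \<longrightarrow> \<phi> t = 0"
      using AE_lborel_singleton[of c] by eventually_elim auto
    then have "AE x in M. X x \<notin> {c}" by (intro null) simp
    then show ?thesis by simp
  qed
  have pos: "0 < prob {x \<in> space M. X x \<in> A}"
    if "B \<subseteq> A" "A \<in> sets borel" "B \<in> sets borel" "0 < (\<integral>\<^sup>+t\<in>B. ennreal (\<phi> t) \<partial>lborel)" for A B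
  proof -
    have "0 < emeasure M {x \<in> space M. X x \<in> B}" using em that by simp
    also have "\<dots> \<le> emeasure M {x \<in> space M. X x \<in> A}"
      by (rule emeasure_mono) (use that in auto)
    finally show ?thesis by (simp add: emeasure_eq_measure)
  qed
  have supp_ae: "AE t in lborel. t \<notin> {a..b} \<longrightarrow> \<phi> t = 0"
    and left: "\<And>e. 0 < e \<Longrightarrow> 0 < (\<integral>\<^sup>+t\<in>{a..a + e}. ennreal (\<phi> t) \<partial>lborel)"
    and right: "\<And>e. 0 < e \<Longrightarrow> 0 < (\<integral>\<^sup>+t\<in>{b - e..b}. ennreal (\<phi> t) \<partial>lborel)"
    using supp by (simp_all add: supported_on_def)
  show ?thesis
  proof
    show "X \<in> borel_measurable M" by simp
    show "AE x in M. a \<le> X x \<and> X x \<le> b"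
    proof -
      have "AE x in M. X x \<notin> - {a..b}" using supp_ae by (intro null) simp_all
      then show ?thesis by simp
    qed
    show "AE x in M. X x \<noteq> c" for c by (rule atom)
    show "0 < prob {x \<in> space M. X x \<le> r}" if "a < r" for r
      using pos[OF _ _ _ left[of "r - a"], of "{..r}"] that by simp
    show "0 < prob {x \<in> space M. r < X x}" if "r < b" for r
    proof -
      \<comment> \<open>Half the distance keeps the closed interval inside the open half-line, as
        the event \<open>r < X\<close> is strict.\<close>
      have "{b - (b - r) / 2..b} \<subseteq> {r<..}" using that by (auto simp: field_simps)
      then show ?thesis using pos[OF _ _ _ right[of "(b - r) / 2"], of "{r<..}"] that by simp
    qed
  qed
qed

theorem corollary3p3:
  fixes M :: "'x measure" and Tmin :: "'x \<Rightarrow> real"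
    and \<phi> :: "real \<Rightarrow> real" and \<alpha> a b :: real
  assumes "prob_space M"
    and "\<alpha> \<in> {0..1}"
    and "distributed M lborel Tmin (\<lambda>t. ennreal (\<phi> t))"
    and "\<forall>t. 0 \<le> \<phi> t"
    and "supported_on \<phi> a b"
  shows
    "(\<forall>r. J \<alpha> M Tmin differentiable at r) \<and>
     continuous_on UNIV (deriv (J \<alpha> M Tmin)) \<and>
     (\<exists>rs\<in>{a..b}.
        deriv (J \<alpha> M Tmin) rs = 0 \<and>
        (\<forall>r\<in>{a<..b}. deriv (J \<alpha> M Tmin) r = 0 \<longrightarrow> r = rs) \<and>
        (a < rs \<longleftrightarrow> nontrivial_threshold \<alpha> M Tmin a) \<and>
        optimal_control \<alpha> M Tmin (\<lambda>x. max rs (Tmin x)) \<and>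
        (\<forall>T. optimal_control \<alpha> M Tmin T \<longrightarrow>
           (\<exists>r. deriv (J \<alpha> M Tmin) r = 0 \<and> (0 < \<alpha> \<longrightarrow> r = rs) \<and>
                (AE x in M. T x = max r (Tmin x)))))"
proof -
  interpret bounded_atomless_rv M Tmin a b
    by (rule bounded_atomless_rv_distributed) fact+
  have \<alpha>: "0 \<le> \<alpha>" "\<alpha> \<le> 1" using assms(2) by auto
  obtain rs where rs: "a \<le> rs" "rs \<le> b" "0 \<le> \<alpha> - (1 - \<alpha>) * h rs"
    "a < rs \<Longrightarrow> \<alpha> - (1 - \<alpha>) * h rs = 0"
    "0 < \<alpha> \<Longrightarrow> rs < b" "\<alpha> = 0 \<Longrightarrow> rs = b"
    "\<And>r. a < r \<Longrightarrow> r \<le> b \<Longrightarrow> \<alpha> - (1 - \<alpha>) * h r = 0 \<Longrightarrow> r = rs"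
    "a < rs \<longleftrightarrow> \<alpha> - (1 - \<alpha>) * h a < 0"
    by (rule threshold_exists[OF \<alpha>]) (rule that; assumption)
  note opt = \<alpha> rs(1,2,5,6,3,4)
  have adm: "admissible M Tmin (\<lambda>x. max rs (Tmin x))"
    by (auto simp: admissible_def)
  show ?thesis
  proof (intro conjI allI impI bexI[of _ rs] ballI)
    show "J \<alpha> M Tmin differentiable at r" for r
      using DERIV_J[of \<alpha> r] real_differentiable_def by blast
    show "continuous_on UNIV (deriv (J \<alpha> M Tmin))"
      unfolding deriv_J[abs_def]
      by (intro continuous_at_imp_continuous_on ballI continuous_intros isCont_F isCont_h)
    \<comment> \<open>In the degenerate case \<open>rs = a\<close> the derivative vanishes through
      its factor \<open>F\<close>, whatever the second factor is.\<close>
    show "deriv (J \<alpha> M Tmin) rs = 0"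
      using rs(1,4) F_eq_0[of a] by (cases "a < rs") (auto simp: deriv_J)
    show "r = rs" if "r \<in> {a<..b}" "deriv (J \<alpha> M Tmin) r = 0" for r
      using rs(7)[of r] that F_pos[of r] by (simp add: deriv_J)
    show "a < rs \<longleftrightarrow> nontrivial_threshold \<alpha> M Tmin a"
      using rs(8) nontrivial_threshold_iff by simp
    show "optimal_control \<alpha> M Tmin (\<lambda>x. max rs (Tmin x))"
      unfolding optimal_control_def using adm cost_max_le[OF opt] by blast
    show "\<exists>r. deriv (J \<alpha> M Tmin) r = 0 \<and> (0 < \<alpha> \<longrightarrow> r = rs) \<and> (AE x in M. T x = max r (Tmin x))"
      if "optimal_control \<alpha> M Tmin T" for T
    proof (rule minimizer_unique[OF opt])
      show "admissible M Tmin T" using that by (simp add: optimal_control_def)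
      show "cost \<alpha> M T \<le> ereal (J \<alpha> M Tmin rs)"
        using that adm by (auto simp: optimal_control_def cost_max[symmetric])
    qed
    show "rs \<in> {a..b}" using rs by simp
  qed
qed

end
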